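(* Let $(X,\mathsf d)$ be a metric space equipped with a stratified measure $\mu=\mu_1+\cdots+\mu_k$, with associated closed sets $Y_1,\dots,Y_k\subset X$ and Ahlfors dimensions $Q_1<\dots<Q_k$, and let $u\in L^1_{\mathrm{loc}}(X,\mu)$. For any $x\in\bigcap_{i=1}^{l}Y_{j_i}$, where $\{j_i\}$ is an increasing subsequence of $\{1,\dots,k\}$, if $\Delta_{\mu_{j_1}}^{\mathsf d}u(x)$ exists and $$r^{Q_{j_i}-Q_{j_1}}\,\big|\Delta_{\mu_{j_i},r}^{\mathsf d}u(x)\big|\to 0\quad\text{as } r\to0^+\qquad\text{for all } 2\le i\le l,$$ then $\Delta_{\mu}^{\mathsf d}u(x)$ exists and $$\Delta_{\mu}^{\mathsf d}u(x)=\Delta_{\mu_{j_1}}^{\mathsf d}u(x).$$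
   Context: $B_r(x)$ denotes the ball of center $x$ and radius $r$ in $(X,\mathsf d)$. For a Borel measure $\nu$ on $X$, the (pointwise) asymptotic mean value (AMV) quantities are $$\Delta_{\nu,r}^{\mathsf d}u(x):=\frac1{r^2}\,\frac{1}{\nu(B_r(x))}\int_{B_r(x)}\big(u(y)-u(x)\big)\,d\nu(y)\quad(r>0),\qquad \Delta_\nu^{\mathsf d}u(x):=\lim_{r\to0^+}\Delta_{\nu,r}^{\mathsf d}u(x),$$ the latter (the AMV Laplacian) being said to exist at $x$ when the limit exists. Convention: a function $u\in L^1_{\mathrm{loc}}(X,\mu)$ is evaluated pointwise through its representative whose value at $x$ is $\lim_{r\to0^+}\mu(B_r(x))^{-1}\int_{B_r(x)}u\,d\mu$ whenever this limit exists. For $Q\ge0$, a Borel measure $\nu$ on a metric space $(Y,\mathsf d)$ is Ahlfors $Q$-regular if there are constants $c,C>0$ such that $cr^Q\le\nu(B)\le Cr^Q$ for every metric ball $B\subset Y$ of radius $r>0$ ($c,C$ independent of $r$ and of the ball); $Q$ is then called its Ahlfors dimension. A measure $\mu$ on a metric space $(X,\mathsf d)$ is called stratified if $\mu=\mu_1+\dots+\mu_k$ where for each $1\le j\le k$: (i) $\mu_j$ is a measure supported on a closed set $Y_j\subset X$; (ii) $\mu_j$ is Ahlfors $Q_j$-regular on $(Y_j,\mathsf d|_{Y_j})$; (iii) $Q_1<\dots<Q_k$.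
   Formalization: The subsequence {j_i} is required to list all strata containing x: x lies in no other Y_n. Without this the claim is false, e.g. length on a line plus Lebesgue measure on the plane, with only the plane listed. *)

theory Defs
  imports "HOL-Analysis.Analysis"
begin

definition amv_quotient :: "'a::metric_space measure \<Rightarrow> real \<Rightarrow> ('a \<Rightarrow> real) \<Rightarrow> 'a \<Rightarrow> real" where
  "amv_quotient \<nu> r u x =
     1 / r\<^sup>2 * (1 / measure \<nu> (ball x r) * (LINT y:ball x r|\<nu>. (u y - u x)))"

definition amv_laplacian_exists :: "'a::metric_space measure \<Rightarrow> ('a \<Rightarrow> real) \<Rightarrow> 'a \<Rightarrow> bool" where
  "amv_laplacian_exists \<nu> u x \<longleftrightarrow>
     (\<exists>L. ((\<lambda>r. amv_quotient \<nu> r u x) \<longlongrightarrow> L) (at_right 0))"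

text \<open>Only meaningful when \<open>amv_laplacian_exists \<nu> u x\<close> holds.\<close>

definition amv_laplacian :: "'a::metric_space measure \<Rightarrow> ('a \<Rightarrow> real) \<Rightarrow> 'a \<Rightarrow> real" where
  "amv_laplacian \<nu> u x = Lim (at_right 0) (\<lambda>r. amv_quotient \<nu> r u x)"

text \<open>Local integrability is meant in the neighbourhood sense, since \<open>'a\<close> need not be
  locally compact.\<close>

definition locally_L1 :: "'a::metric_space measure \<Rightarrow> ('a \<Rightarrow> real) \<Rightarrow> bool" where
  "locally_L1 \<mu> u \<longleftrightarrow>
     u \<in> borel_measurable \<mu> \<and> (\<forall>x. \<exists>r>0. set_integrable \<mu> (ball x r) u)"

text \<open>An element of \<open>L\<^sup>1\<^sub>l\<^sub>o\<^sub>c\<close> is a class of functions modulo null sets. In \<open>precise_representative \<mu> u v\<close>,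
  \<open>u\<close> is an arbitrary member of the class, and \<open>v\<close> is a member whose value at each point is the limit
  of the averages over shrinking balls whenever that limit exists. The positivity condition on balls is
  there because \<open>1 / 0 = 0\<close> in HOL: without it the averages would spuriously converge to 0 off
  the support of \<open>\<mu>\<close>.\<close>

definition precise_representative ::
    "'a::metric_space measure \<Rightarrow> ('a \<Rightarrow> real) \<Rightarrow> ('a \<Rightarrow> real) \<Rightarrow> bool" where
  "precise_representative \<mu> u v \<longleftrightarrow>
     v \<in> borel_measurable \<mu> \<and> (AE y in \<mu>. v y = u y) \<and>
     (\<forall>y L. (\<forall>r>0. emeasure \<mu> (ball y r) > 0) \<longrightarrow>
        ((\<lambda>r. 1 / measure \<mu> (ball y r) * (LINT z:ball y r|\<mu>. u z)) \<longlongrightarrow> L) (at_right 0) \<longrightarrow>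
        v y = L)"

text \<open>\<open>Y \<inter> ball y r\<close> is the open ball of the subspace \<open>Y\<close>. The measure lives on the ambient type, and
  only its values on Borel subsets of \<open>Y\<close> matter here.\<close>

definition ahlfors_regular_on :: "'a::metric_space set \<Rightarrow> real \<Rightarrow> 'a measure \<Rightarrow> bool" where
  "ahlfors_regular_on Y Q \<nu> \<longleftrightarrow>
     Q \<ge> 0 \<and> sets \<nu> = sets borel \<and>
     (\<exists>c>0. \<exists>C>0. \<forall>y\<in>Y. \<forall>r>0.
        ennreal (c * r powr Q) \<le> emeasure \<nu> (Y \<inter> ball y r) \<and>
        emeasure \<nu> (Y \<inter> ball y r) \<le> ennreal (C * r powr Q))"

text \<open>The strata are indexed by \<open>{1..k}\<close>. The equation \<open>\<mu> = \<mu>\<^sub>1 + \<dots> + \<mu>\<^sub>k\<close> is stated on Borel sets.\<close>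

definition stratified_measure ::
    "nat \<Rightarrow> (nat \<Rightarrow> 'a::metric_space measure) \<Rightarrow> (nat \<Rightarrow> 'a set) \<Rightarrow> (nat \<Rightarrow> real) \<Rightarrow> 'a measure \<Rightarrow> bool" where
  "stratified_measure k m Y Q \<mu> \<longleftrightarrow>
     sets \<mu> = sets borel \<and>
     (\<forall>A\<in>sets borel. emeasure \<mu> A = (\<Sum>j=1..k. emeasure (m j) A)) \<and>
     (\<forall>j\<in>{1..k}. sets (m j) = sets borel \<and> closed (Y j) \<and> emeasure (m j) (- Y j) = 0) \<and>
     (\<forall>j\<in>{1..k}. ahlfors_regular_on (Y j) (Q j) (m j)) \<and>
     strict_mono_on {1..k} Q"

end

theory Submission
  imports Defs
begin

text \<open>
  On a ball \<open>B\<close> of small radius \<open>r\<close> about \<open>x\<close>, integration against \<open>\<mu>\<close> is the sum of the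
  integrations against the strata, so the AMV quotient of \<open>\<mu>\<close> is the average of the quotients of the
  strata with weights \<open>\<mu>\<^sub>n(B) / \<mu>(B)\<close> (lemma \<open>amv_quotient_sum_measure\<close>). A stratum that does not
  contain \<open>x\<close> has weight 0 once \<open>r\<close> is small, because its support is closed. Among those that do
  contain \<open>x\<close>, the one of lowest dimension \<open>Q\<^sub>1\<close> has the largest balls: by Ahlfors regularity a stratum
  of dimension \<open>Q\<^sub>i > Q\<^sub>1\<close> has weight at most a constant times \<open>r\<close> to the power \<open>Q\<^sub>i - Q\<^sub>1\<close>
  (lemma \<open>ahlfors_mass_ratio_le\<close>). Such a weight tends to 0, so the lowest stratum has asymptotic
  weight 1; and this power of \<open>r\<close> is exactly the one that the decay hypothesis on the quotient of the
  higher stratum compensates, so the higher strata contribute nothing in the limit.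

  The quotient of \<open>\<mu>\<close> splits in this way only if \<open>v\<close> is integrable near \<open>x\<close>. It is so because
  it agrees almost everywhere with the locally integrable function \<open>u\<close>.
\<close>

section \<open>Integration against a finite sum of measures\<close>

lemma nn_integral_sum_measure:
  fixes M :: "'a measure"
  assumes I: "finite I"
    and sets: "\<And>i. i \<in> I \<Longrightarrow> sets (N i) = sets M"
    and em: "\<And>A. A \<in> sets M \<Longrightarrow> emeasure M A = (\<Sum>i\<in>I. emeasure (N i) A)"
    and f: "f \<in> borel_measurable M"
  shows "(\<integral>\<^sup>+x. f x \<partial>M) = (\<Sum>i\<in>I. \<integral>\<^sup>+x. f x \<partial>N i)"
proof -
  have meas: "g \<in> borel_measurable (N i)" if "g \<in> borel_measurable M" "i \<in> I"
    for g :: "'a \<Rightarrow> ennreal" and i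
    using that measurable_cong_sets[OF sets[OF that(2)] refl] by blast
  have space: "space (N i) = space M" if "i \<in> I" for i
    using sets_eq_imp_space_eq[OF sets[OF that]] .
  from f show ?thesis
  proof (induction rule: borel_measurable_induct)
    case (cong f g)
    have "(\<integral>\<^sup>+x. g x \<partial>N i) = (\<integral>\<^sup>+x. f x \<partial>N i)" if "i \<in> I" for i
      by (rule nn_integral_cong) (simp add: cong space[OF that])
    moreover have "(\<integral>\<^sup>+x. g x \<partial>M) = (\<integral>\<^sup>+x. f x \<partial>M)"
      by (rule nn_integral_cong) (simp add: cong)
    ultimately show ?case using cong by simp
  next
    case (set A)
    then show ?case by (simp add: em sets)
  next
    case (mult u c)
    then show ?case by (simp add: nn_integral_cmult meas sum_distrib_left)
  next
    case (add u w)
    then show ?case by (simp add: nn_integral_add meas sum.distrib)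
  next
    case (seq U)
    have mono: "incseq (\<lambda>n. \<integral>\<^sup>+x. U n x \<partial>N i)" for i
      using seq by (auto simp: incseq_def le_fun_def intro!: nn_integral_mono)
    have "(\<integral>\<^sup>+x. (SUP n. U n) x \<partial>M) = (SUP n. \<integral>\<^sup>+x. U n x \<partial>M)"
      using seq by (simp add: image_comp nn_integral_monotone_convergence_SUP)
    also have "\<dots> = (SUP n. \<Sum>i\<in>I. \<integral>\<^sup>+x. U n x \<partial>N i)"
      using seq by simp
    also have "\<dots> = (\<Sum>i\<in>I. SUP n. \<integral>\<^sup>+x. U n x \<partial>N i)"
      by (rule ennreal_SUP_sum) (use mono in auto)
    also have "\<dots> = (\<Sum>i\<in>I. \<integral>\<^sup>+x. (SUP n. U n) x \<partial>N i)"
      using seq by (intro sum.cong refl)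
        (simp add: image_comp nn_integral_monotone_convergence_SUP meas)
    finally show ?case .
  qed
qed

text \<open>A single summand is dominated by \<open>M\<close>, so the positive and negative parts of \<open>f\<close> have finite
  integrals against each of them, and the nonnegative case applies to both parts.\<close>

lemma
  fixes f :: "'a \<Rightarrow> real"
  assumes I: "finite I"
    and sets: "\<And>i. i \<in> I \<Longrightarrow> sets (N i) = sets M"
    and em: "\<And>A. A \<in> sets M \<Longrightarrow> emeasure M A = (\<Sum>i\<in>I. emeasure (N i) A)"
    and f: "integrable M f"
  shows integrable_sum_measureD: "\<And>i. i \<in> I \<Longrightarrow> integrable (N i) f"
    and integral_sum_measure: "(\<integral>x. f x \<partial>M) = (\<Sum>i\<in>I. \<integral>x. f x \<partial>N i)"
proof -
  note split = nn_integral_sum_measure[OF I sets em]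
  have fM: "f \<in> borel_measurable M" using f by simp
  show int: "integrable (N i) f" if "i \<in> I" for i
  proof (rule integrableI_bounded)
    show "f \<in> borel_measurable (N i)"
      using fM measurable_cong_sets[OF sets[OF that] refl] by blast
    have "(\<integral>\<^sup>+x. norm (f x) \<partial>N i) \<le> (\<Sum>i\<in>I. \<integral>\<^sup>+x. norm (f x) \<partial>N i)"
      using that I by (intro member_le_sum) auto
    also have "\<dots> = (\<integral>\<^sup>+x. norm (f x) \<partial>M)"
      using fM by (intro split[symmetric]) auto
    also have "\<dots> < \<infinity>" using f by (simp add: integrable_iff_bounded)
    finally show "(\<integral>\<^sup>+x. norm (f x) \<partial>N i) < \<infinity>" .
  qed
  have fin: "(\<integral>\<^sup>+x. ennreal (g x) \<partial>N i) \<noteq> \<infinity>"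
    if "i \<in> I" "\<And>x. g x \<le> \<bar>f x\<bar>" for i and g :: "'a \<Rightarrow> real"
  proof -
    have "(\<integral>\<^sup>+x. ennreal (g x) \<partial>N i) \<le> (\<integral>\<^sup>+x. norm (f x) \<partial>N i)"
      by (intro nn_integral_mono ennreal_leI) (use that in auto)
    also have "\<dots> < \<infinity>" using int[OF that(1)] by (simp add: integrable_iff_bounded)
    finally show ?thesis by simp
  qed
  have part: "enn2real (\<integral>\<^sup>+x. ennreal (g x) \<partial>M) = (\<Sum>i\<in>I. enn2real (\<integral>\<^sup>+x. ennreal (g x) \<partial>N i))"
    if g: "g \<in> borel_measurable M" "\<And>x. g x \<le> \<bar>f x\<bar>" for g :: "'a \<Rightarrow> real"
  proof -
    have "(\<integral>\<^sup>+x. ennreal (g x) \<partial>M) = (\<Sum>i\<in>I. \<integral>\<^sup>+x. ennreal (g x) \<partial>N i)"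
      using g by (intro split) auto
    also have "enn2real \<dots> = (\<Sum>i\<in>I. enn2real (\<integral>\<^sup>+x. ennreal (g x) \<partial>N i))"
      using enn2real_sum[of I "\<lambda>i. \<integral>\<^sup>+x. ennreal (g x) \<partial>N i"] fin g by (simp add: less_top)
    finally show ?thesis .
  qed
  show "(\<integral>x. f x \<partial>M) = (\<Sum>i\<in>I. \<integral>x. f x \<partial>N i)"
    using part[of f] part[of "\<lambda>x. - f x"] fM f int
    by (simp add: real_lebesgue_integral_def sum_subtractf)
qed

section \<open>The mean value quotient of a sum of measures\<close>

text \<open>A ball of mass 0 gives the quotient the default value \<open>1 / 0 = 0\<close>, which does no harm in this
  product form, because the integral over such a ball vanishes as well. Hence strata that miss the
  ball need no separate treatment in the averaging formula.\<close>

lemma set_integral_eq_amv_quotient: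
  assumes "r > 0" "sets \<nu> = sets borel" "emeasure \<nu> (ball x r) \<noteq> \<infinity>"
  shows "(LINT y:ball x r|\<nu>. (u y - u x)) = r\<^sup>2 * measure \<nu> (ball x r) * amv_quotient \<nu> r u x"
proof (cases "measure \<nu> (ball x r) = 0")
  case True
  with assms have "ball x r \<in> null_sets \<nu>"
    by (simp add: null_sets_def emeasure_eq_ennreal_measure)
  then have "(LINT y:ball x r|\<nu>. (u y - u x)) = 0"
    unfolding set_lebesgue_integral_def
    by (intro integral_eq_zero_AE AE_I'[where N = "ball x r"]) (auto simp: indicator_def)
  with True show ?thesis by simp
next
  case False
  with assms show ?thesis by (simp add: amv_quotient_def)
qed

text \<open>The integrals of \<open>u - u x\<close> over the ball add up, and each of them is the mass of the ball times
  \<open>r\<^sup>2\<close> times a quotient; dividing by the total mass turns the sum into a weighted average.\<close>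

lemma amv_quotient_sum_measure:
  assumes I: "finite I"
    and setsM: "sets M = sets borel"
    and sets: "\<And>i. i \<in> I \<Longrightarrow> sets (N i) = sets borel"
    and em: "\<And>A. A \<in> sets borel \<Longrightarrow> emeasure M A = (\<Sum>i\<in>I. emeasure (N i) A)"
    and r: "r > 0"
    and fin: "emeasure M (ball x r) \<noteq> \<infinity>"
    and int: "set_integrable M (ball x r) u"
  shows "amv_quotient M r u x =
    (\<Sum>i\<in>I. measure (N i) (ball x r) / measure M (ball x r) * amv_quotient (N i) r u x)"
proof -
  have fin_i: "emeasure (N i) (ball x r) \<noteq> \<infinity>" if "i \<in> I" for i
  proof -
    have "emeasure (N i) (ball x r) \<le> (\<Sum>i\<in>I. emeasure (N i) (ball x r))"
      using that I by (intro member_le_sum) auto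
    with fin show ?thesis by (auto simp: em top_unique)
  qed
  have "set_integrable M (ball x r) (\<lambda>_. u x)"
    unfolding set_integrable_def using fin setsM by (simp add: less_top)
  then have "set_integrable M (ball x r) (\<lambda>y. u y - u x)"
    using int by (rule set_integral_diff[rotated])
  then have "(LINT y:ball x r|M. (u y - u x)) = (\<Sum>i\<in>I. LINT y:ball x r|N i. (u y - u x))"
    unfolding set_integrable_def set_lebesgue_integral_def
    by (intro integral_sum_measure) (use I setsM sets em in auto)
  also have "\<dots> = r\<^sup>2 * (\<Sum>i\<in>I. measure (N i) (ball x r) * amv_quotient (N i) r u x)"
    using r sets fin_i
    by (simp add: set_integral_eq_amv_quotient sum_distrib_left mult.assoc)
  finally show ?thesis
    using r by (simp add: amv_quotient_def[of M] sum_divide_distrib)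
qed

section \<open>Ahlfors regular strata\<close>

text \<open>Regularity speaks about the balls \<open>Y \<inter> ball y r\<close> of the subspace, while AMV quotients use ambient
  balls; the two have equal mass because \<open>\<nu>\<close> is carried by \<open>Y\<close>.\<close>

lemma ahlfors_measure_ball:
  assumes "ahlfors_regular_on Y Q \<nu>" "closed Y" "emeasure \<nu> (- Y) = 0"
  obtains c C where "c > 0" "C > 0"
    "\<And>y r. y \<in> Y \<Longrightarrow> r > 0 \<Longrightarrow> emeasure \<nu> (ball y r) \<noteq> \<infinity>"
    "\<And>y r. y \<in> Y \<Longrightarrow> r > 0 \<Longrightarrow> c * r powr Q \<le> measure \<nu> (ball y r)"
    "\<And>y r. y \<in> Y \<Longrightarrow> r > 0 \<Longrightarrow> measure \<nu> (ball y r) \<le> C * r powr Q"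
proof -
  from assms(1) obtain c C where sets: "sets \<nu> = sets borel" and pos: "c > 0" "C > 0"
    and bd: "\<And>y r. y \<in> Y \<Longrightarrow> r > 0 \<Longrightarrow>
        ennreal (c * r powr Q) \<le> emeasure \<nu> (Y \<inter> ball y r) \<and>
        emeasure \<nu> (Y \<inter> ball y r) \<le> ennreal (C * r powr Q)"
    unfolding ahlfors_regular_on_def by blast
  have Y: "- Y \<in> null_sets \<nu>" using assms sets by (auto simp: null_sets_def)
  have eq: "emeasure \<nu> (ball y r) = emeasure \<nu> (Y \<inter> ball y r)" for y r
  proof -
    have "Y \<inter> ball y r = ball y r - (- Y)" by auto
    then show ?thesis using emeasure_Diff_null_set[OF Y, of "ball y r"] sets by simp
  qed
  have fin: "emeasure \<nu> (ball y r) \<noteq> \<infinity>" if "y \<in> Y" "r > 0" for y r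
    using bd[OF that] by (auto simp: eq top_unique)
  have "c * r powr Q \<le> measure \<nu> (ball y r)" "measure \<nu> (ball y r) \<le> C * r powr Q"
    if "y \<in> Y" "r > 0" for y r
    using bd[OF that] fin[OF that] pos
    by (auto simp: eq[symmetric] emeasure_eq_ennreal_measure)
  with that pos fin show thesis by blast
qed

lemma ahlfors_mass_ratio_le:
  assumes 0: "ahlfors_regular_on Y0 Q0 \<nu>0" "closed Y0" "emeasure \<nu>0 (- Y0) = 0" "x \<in> Y0"
    and 1: "ahlfors_regular_on Y1 Q1 \<nu>1" "closed Y1" "emeasure \<nu>1 (- Y1) = 0" "x \<in> Y1"
  obtains K where "\<And>r. r > 0 \<Longrightarrow>
    measure \<nu>1 (ball x r) / measure \<nu>0 (ball x r) \<le> K * r powr (Q1 - Q0)"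
proof -
  obtain c C where c: "c > 0"
    and lo: "\<And>y r. y \<in> Y0 \<Longrightarrow> r > 0 \<Longrightarrow> c * r powr Q0 \<le> measure \<nu>0 (ball y r)"
    using ahlfors_measure_ball[OF 0(1-3)] by metis
  obtain c' C' where C': "C' > 0"
    and hi: "\<And>y r. y \<in> Y1 \<Longrightarrow> r > 0 \<Longrightarrow> measure \<nu>1 (ball y r) \<le> C' * r powr Q1"
    using ahlfors_measure_ball[OF 1(1-3)] by metis
  show thesis
  proof (rule that[of "C' / c"])
    fix r :: real assume r: "r > 0"
    have "measure \<nu>1 (ball x r) / measure \<nu>0 (ball x r) \<le> (C' * r powr Q1) / (c * r powr Q0)"
      using c C' r by (intro frac_le lo hi 0 1) auto
    then show "measure \<nu>1 (ball x r) / measure \<nu>0 (ball x r) \<le> C' / c * r powr (Q1 - Q0)"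
      by (simp add: powr_diff)
  qed
qed

lemma eventually_emeasure_ball_eq_0:
  assumes "sets \<nu> = sets borel" "closed Y" "emeasure \<nu> (- Y) = 0" "x \<notin> Y"
  shows "\<forall>\<^sub>F r in at_right 0. emeasure \<nu> (ball x r) = 0"
proof -
  from assms obtain e where e: "e > 0" "ball x e \<subseteq> - Y"
    using open_contains_ball_eq[of "- Y" x] by (auto simp: open_Compl)
  have "emeasure \<nu> (ball x r) = 0" if "r < e" for r
  proof -
    have "emeasure \<nu> (ball x r) \<le> emeasure \<nu> (- Y)"
      using e that assms by (intro emeasure_mono) force+
    with assms show ?thesis by simp
  qed
  then show ?thesis
    using e(1) by (auto simp: eventually_at_right_field)
qed

lemma set_integrable_precise_representative:
  assumes "locally_L1 \<mu> u" "precise_representative \<mu> u v" "sets \<mu> = sets borel"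
  shows "\<forall>\<^sub>F r in at_right 0. set_integrable \<mu> (ball x r) v"
proof -
  obtain e where e: "e > 0" "set_integrable \<mu> (ball x e) u"
    using assms unfolding locally_L1_def by blast
  have ball: "ball x r \<in> sets \<mu>" for r using assms(3) by simp
  have meas: "u \<in> borel_measurable \<mu>" "v \<in> borel_measurable \<mu>" and ae: "AE y in \<mu>. v y = u y"
    using assms unfolding locally_L1_def precise_representative_def by auto
  have "set_integrable \<mu> (ball x r) v" if "r < e" for r
  proof -
    have "set_integrable \<mu> (ball x r) u"
      using e(2) by (rule set_integrable_subset) (use that ball in auto)
    then have "integrable \<mu> (\<lambda>y. indicat_real (ball x r) y *\<^sub>R v y)"
      unfolding set_integrable_def
      by (rule integrable_cong_AE_imp) (use meas ae ball in \<open>auto intro!: borel_measurable_times borel_measurable_indicator\<close>)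
    then show ?thesis unfolding set_integrable_def .
  qed
  then show ?thesis
    using e(1) by (auto simp: eventually_at_right_field)
qed

section \<open>The lowest stratum determines the limit\<close>

text \<open>Since the weights add up to 1, the weight of the distinguished index tends to 1 as soon as all
  the other weights vanish in the limit.\<close>

lemma tendsto_weighted_average_dominant:
  fixes w q :: "'i \<Rightarrow> 'b \<Rightarrow> real"
  assumes I: "finite I" "a \<in> I"
    and one: "\<forall>\<^sub>F r in F. (\<Sum>i\<in>I. w i r) = 1"
    and w: "\<And>i. i \<in> I - {a} \<Longrightarrow> (w i \<longlongrightarrow> 0) F"
    and wq: "\<And>i. i \<in> I - {a} \<Longrightarrow> ((\<lambda>r. w i r * q i r) \<longlongrightarrow> 0) F"
    and q: "(q a \<longlongrightarrow> L) F"
  shows "((\<lambda>r. \<Sum>i\<in>I. w i r * q i r) \<longlongrightarrow> L) F"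
proof -
  have "((\<lambda>r. 1 - (\<Sum>i\<in>I-{a}. w i r)) \<longlongrightarrow> 1 - (\<Sum>i\<in>I-{a}. 0)) F"
    by (intro tendsto_intros w)
  moreover have "\<forall>\<^sub>F r in F. 1 - (\<Sum>i\<in>I-{a}. w i r) = w a r"
    using one by eventually_elim (simp add: sum.remove[OF I])
  ultimately have "(w a \<longlongrightarrow> 1) F"
    by (auto intro: Lim_transform_eventually)
  then have "((\<lambda>r. w a r * q a r + (\<Sum>i\<in>I-{a}. w i r * q i r)) \<longlongrightarrow> 1 * L + (\<Sum>i\<in>I-{a}. 0)) F"
    by (intro tendsto_intros q wq)
  then show ?thesis by (simp add: sum.remove[OF I])
qed

theorem theorem3p2:
  fixes \<mu> :: "'a::metric_space measure"
    and m :: "nat \<Rightarrow> 'a measure"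
    and Y :: "nat \<Rightarrow> 'a set"
    and Q :: "nat \<Rightarrow> real"
    and u v :: "'a \<Rightarrow> real"
    and j :: "nat \<Rightarrow> nat"
    and k l :: nat
    and x :: 'a
  assumes strat: "stratified_measure k m Y Q \<mu>"
    and u: "locally_L1 \<mu> u"
    and v: "precise_representative \<mu> u v"
    and l: "l \<ge> 1"
    and j_range: "j ` {1..l} \<subseteq> {1..k}"
    and j_mono: "strict_mono_on {1..l} j"
    and x_in: "x \<in> (\<Inter>i\<in>{1..l}. Y (j i))"
    and x_notin: "\<And>n. n \<in> {1..k} - j ` {1..l} \<Longrightarrow> x \<notin> Y n"
    and ex: "amv_laplacian_exists (m (j 1)) v x"
    and decay: "\<And>i. i \<in> {2..l} \<Longrightarrow>
      ((\<lambda>r. r powr (Q (j i) - Q (j 1)) * \<bar>amv_quotient (m (j i)) r v x\<bar>) \<longlongrightarrow> 0) (at_right 0)"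
  shows "amv_laplacian_exists \<mu> v x \<and> amv_laplacian \<mu> v x = amv_laplacian (m (j 1)) v x"
proof -
  define a where "a = j 1"
  define B where "B = ball x"
  define w where "w n r = measure (m n) (B r) / measure \<mu> (B r)" for n r
  define q where "q n r = amv_quotient (m n) r v x" for n r
  have sets\<mu>: "sets \<mu> = sets borel"
    and em: "\<And>A. A \<in> sets borel \<Longrightarrow> emeasure \<mu> A = (\<Sum>n=1..k. emeasure (m n) A)"
    and sets: "\<And>n. n \<in> {1..k} \<Longrightarrow> sets (m n) = sets borel"
    and Y: "\<And>n. n \<in> {1..k} \<Longrightarrow> closed (Y n)" "\<And>n. n \<in> {1..k} \<Longrightarrow> emeasure (m n) (- Y n) = 0"
    and reg: "\<And>n. n \<in> {1..k} \<Longrightarrow> ahlfors_regular_on (Y n) (Q n) (m n)"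
    and Q_mono: "strict_mono_on {1..k} Q"
    using strat unfolding stratified_measure_def by auto
  have "1 \<in> {1..l}" using l by simp
  then have a: "a \<in> {1..k}" "x \<in> Y a"
    using j_range x_in unfolding a_def by blast+

  have zero: "\<forall>\<^sub>F r in at_right 0. emeasure (m n) (B r) = 0"
    if "n \<in> {1..k}" "x \<notin> Y n" for n
    unfolding B_def using eventually_emeasure_ball_eq_0 sets Y that by blast
  have fin1: "\<forall>\<^sub>F r in at_right 0. emeasure (m n) (B r) \<noteq> \<infinity>" if n: "n \<in> {1..k}" for n
  proof (cases "x \<in> Y n")
    case True
    then have "emeasure (m n) (B r) \<noteq> \<infinity>" if "r > 0" for r
      using ahlfors_measure_ball[OF reg[OF n] Y[OF n]] that unfolding B_def by metis
    then show ?thesis by (intro eventually_mono[OF eventually_at_right_less])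
  next
    case False
    with zero[OF n] show ?thesis by (auto elim: eventually_mono)
  qed
  have fin: "\<forall>\<^sub>F r in at_right 0. \<forall>n\<in>{1..k}. emeasure (m n) (B r) \<noteq> \<infinity>"
    using fin1 by (intro eventually_ball_finite) auto
  have pos_r: "\<forall>\<^sub>F r in at_right 0. r > (0::real)"
    by (rule eventually_at_right_less)
  have pos: "measure (m a) (B r) > 0" if "r > 0" for r
  proof -
    obtain c where "c > 0" "c * r powr Q a \<le> measure (m a) (B r)"
      using ahlfors_measure_ball[OF reg[OF a(1)] Y[OF a(1)]] a(2) \<open>r > 0\<close> unfolding B_def by metis
    moreover have "c * r powr Q a > 0" using \<open>c > 0\<close> \<open>r > 0\<close> by simp
    ultimately show ?thesis by linarith
  qed
  have total: "\<forall>\<^sub>F r in at_right 0. emeasure \<mu> (B r) \<noteq> \<infinity> \<and>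
      measure \<mu> (B r) = (\<Sum>n=1..k. measure (m n) (B r))"
    using fin
  proof eventually_elim
    case (elim r)
    have "emeasure \<mu> (B r) = (\<Sum>n=1..k. emeasure (m n) (B r))"
      unfolding B_def by (rule em) simp
    also have "\<dots> = (\<Sum>n=1..k. ennreal (measure (m n) (B r)))"
      using elim by (intro sum.cong refl emeasure_eq_ennreal_measure) auto
    also have "\<dots> = ennreal (\<Sum>n=1..k. measure (m n) (B r))"
      by (simp add: sum_ennreal)
    finally show ?case by (simp add: measure_def sum_nonneg)
  qed
  have mono: "\<forall>\<^sub>F r in at_right 0. measure (m a) (B r) \<le> measure \<mu> (B r)"
    using total by eventually_elim (use a(1) in \<open>auto intro!: member_le_sum\<close>)

  have one: "\<forall>\<^sub>F r in at_right 0. (\<Sum>n=1..k. w n r) = 1"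
    using total mono pos_r
  proof eventually_elim
    case (elim r)
    with pos[of r] have "measure \<mu> (B r) > 0" by simp
    with elim(1) show ?case unfolding w_def by (simp flip: sum_divide_distrib)
  qed
  have split: "\<forall>\<^sub>F r in at_right 0. (\<Sum>n=1..k. w n r * q n r) = amv_quotient \<mu> r v x"
    using total pos_r set_integrable_precise_representative[OF u v sets\<mu>, of x]
  proof eventually_elim
    case (elim r)
    then show ?case
      unfolding w_def q_def B_def
      using amv_quotient_sum_measure[of "{1..k}" \<mu> m r x v] sets\<mu> sets em by simp
  qed

  have vanish: "(w n \<longlongrightarrow> 0) (at_right 0) \<and> ((\<lambda>r. w n r * q n r) \<longlongrightarrow> 0) (at_right 0)"
    if n: "n \<in> {1..k} - {a}" for n
  proof (cases "n \<in> j ` {1..l}")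
    case False
    then have "x \<notin> Y n" using x_notin n by auto
    then have "\<forall>\<^sub>F r in at_right 0. w n r = 0"
      using zero[of n] n by (auto simp: w_def measure_def elim: eventually_mono)
    then show ?thesis
      by (auto intro!: tendsto_eventually elim: eventually_mono)
  next
    case True
    then obtain i where i: "i \<in> {2..l}" "n = j i"
    proof -
      from True obtain i where "i \<in> {1..l}" "n = j i" by blast
      moreover from this have "i \<noteq> 1" using n unfolding a_def by auto
      ultimately show thesis using that[of i] by simp
    qed
    have "a < n"
      using strict_mono_onD[OF j_mono, of 1 i] i unfolding a_def by simp
    then have Q: "Q a < Q n"
      using strict_mono_onD[OF Q_mono a(1), of n] n by simp
    have xn: "x \<in> Y n" using x_in i by auto
    obtain K where K: "\<And>r. r > 0 \<Longrightarrow>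
        measure (m n) (B r) / measure (m a) (B r) \<le> K * r powr (Q n - Q a)"
      using ahlfors_mass_ratio_le[OF reg[OF a(1)] Y[OF a(1)] a(2) reg Y xn] n
      unfolding B_def by blast
    \<comment> \<open>The weight divides by \<open>\<mu>(B)\<close>, which is at least the mass of the lowest stratum.\<close>
    have w_le: "\<forall>\<^sub>F r in at_right 0. \<bar>w n r\<bar> \<le> K * r powr (Q n - Q a)"
      using mono pos_r
    proof eventually_elim
      case (elim r)
      have "w n r \<le> measure (m n) (B r) / measure (m a) (B r)"
        unfolding w_def using elim pos[of r] by (intro divide_left_mono) auto
      also have "\<dots> \<le> K * r powr (Q n - Q a)" using K elim by simp
      finally show ?case by (simp add: w_def)
    qed
    have "((\<lambda>r. r powr (Q n - Q a)) \<longlongrightarrow> 0) (at_right 0)"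
      using Q by (intro tendsto_zero_powrI[where b = "Q n - Q a"])
        (auto intro: eventually_mono[OF pos_r])
    then have "((\<lambda>r. K * r powr (Q n - Q a)) \<longlongrightarrow> 0) (at_right 0)"
      by (rule tendsto_mult_right_zero)
    then have "(w n \<longlongrightarrow> 0) (at_right 0)"
      by (rule Lim_null_comparison[rotated]) (use w_le in simp)
    moreover have "((\<lambda>r. w n r * q n r) \<longlongrightarrow> 0) (at_right 0)"
    proof (rule Lim_null_comparison)
      show "((\<lambda>r. K * (r powr (Q n - Q a) * \<bar>q n r\<bar>)) \<longlongrightarrow> 0) (at_right 0)"
        using decay[OF i(1)] unfolding q_def a_def i(2) by (rule tendsto_mult_right_zero)
      show "\<forall>\<^sub>F r in at_right 0. norm (w n r * q n r) \<le> K * (r powr (Q n - Q a) * \<bar>q n r\<bar>)"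
        using w_le
      proof eventually_elim
        case (elim r)
        then have "\<bar>w n r\<bar> * \<bar>q n r\<bar> \<le> K * r powr (Q n - Q a) * \<bar>q n r\<bar>"
          by (rule mult_right_mono) simp
        then show ?case by (simp add: abs_mult mult.assoc)
      qed
    qed
    ultimately show ?thesis ..
  qed

  obtain L where L: "(q a \<longlongrightarrow> L) (at_right 0)"
    using ex unfolding amv_laplacian_exists_def q_def a_def by blast
  have "((\<lambda>r. \<Sum>n=1..k. w n r * q n r) \<longlongrightarrow> L) (at_right 0)"
    by (rule tendsto_weighted_average_dominant[where a = a]) (use a(1) one vanish L in auto)
  then have "((\<lambda>r. amv_quotient \<mu> r v x) \<longlongrightarrow> L) (at_right 0)"
    using split by (rule Lim_transform_eventually)
  with L show ?thesis
    unfolding amv_laplacian_exists_def amv_laplacian_def q_def a_def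
    by (auto simp: tendsto_Lim)
qed

end
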